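(* Let $n \geq 2$ and let $n \cdot S^1_{4n}$ denote the disjoint union of $n$ copies of the sunlet $S^1_{4n}$. Then there is a homomorphism $\varphi: n \cdot S^1_{4n} \to C_{2n} \,\Box\, C_{2n}$ which is a covering and is 2-to-1 on vertices, such that the restriction of $\varphi$ to the disjoint union of the $n$ cycles $Z(S^1_{4n})$ is an isomorphism onto the union of the $n$ staircases $T_0, \dots, T_{n-1}$, and $\varphi$ is compatible with the FSM orientation of $n \cdot S^1_{4n}$ and the standard orientation of $C_{2n} \,\Box\, C_{2n}$.
   Context: For $p \geq 3$, the sunlet $S^1_p$ is the graph obtained from a cycle $C_p$ by attaching one pendant edge at each vertex of the cycle ($2p$ vertices, $2p$ edges). $Z(S)$ denotes the unique cycle of a sunlet $S$. $C_{2n} \,\Box\, C_{2n}$ has vertex set $\mathbb{Z}_{2n} \times \mathbb{Z}_{2n}$, with $(a,b)$ adjacent to $(a\pm1,b)$ and $(a,b\pm1)$. The staircase $T_0$ is the $4n$-cycle $(0,0),(1,0),(1,1),(2,1),(2,2),(3,2),\ldots,(2n-1,2n-2),(2n-1,2n-1),(0,2n-1)$, closing back to $(0,0)$ (its vertices are $(i,i)$ and $(i+1,i)$ for $i \in \mathbb{Z}_{2n}$); for $k = 0,\dots,n-1$, the staircase $T_k$ is the image of $T_0$ under the translation $(a,b) \mapsto (a+2k,b)$ (so $T_k$ starts at $(2k,0)$). A homomorphism $\varphi: G \to H$ is a map $V(G)\to V(H)$ sending edges to edges; it is a covering if the induced map on edge sets is a bijection; it is 2-to-1 on vertices if every vertex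 of $H$ has exactly two preimages. The FSM orientation of a sunlet orients its cycle as a directed cycle and each pendant edge from its degree-1 vertex toward the cycle vertex; on a disjoint union of sunlets, each component is so oriented. The standard orientation of $C_{2n} \,\Box\, C_{2n}$ directs each edge toward increasing coordinate: $(a,b)\to(a+1,b)$ and $(a,b)\to(a,b+1)$ (indices mod $2n$). $\varphi$ is compatible with orientations if $(\varphi(u),\varphi(w))$ is an arc whenever $(u,w)$ is an arc. *)

theory Defs
  imports Main
begin

text \<open>Undirected graphs, with an edge being the set of its two ends.\<close>

record 'a ugraph =
  verts :: "'a set"
  edges :: "'a set set"

definition simple_graph :: "'a ugraph \<Rightarrow> bool" where
  "simple_graph G \<longleftrightarrow> (\<forall>e \<in> edges G. e \<subseteq> verts G \<and> card e = 2)"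

definition subgraph :: "'a ugraph \<Rightarrow> 'a ugraph \<Rightarrow> bool" where
  "subgraph H G \<longleftrightarrow> simple_graph H \<and> verts H \<subseteq> verts G \<and> edges H \<subseteq> edges G"

definition graph_hom :: "('a \<Rightarrow> 'b) \<Rightarrow> 'a ugraph \<Rightarrow> 'b ugraph \<Rightarrow> bool" where
  "graph_hom f G H \<longleftrightarrow> f ` verts G \<subseteq> verts H \<and> (\<forall>e \<in> edges G. f ` e \<in> edges H)"

definition covering :: "('a \<Rightarrow> 'b) \<Rightarrow> 'a ugraph \<Rightarrow> 'b ugraph \<Rightarrow> bool" where
  "covering f G H \<longleftrightarrow> graph_hom f G H \<and> bij_betw (\<lambda>e. f ` e) (edges G) (edges H)"

definition two_to_one_on_verts :: "('a \<Rightarrow> 'b) \<Rightarrow> 'a ugraph \<Rightarrow> 'b ugraph \<Rightarrow> bool" where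
  "two_to_one_on_verts f G H \<longleftrightarrow> (\<forall>w \<in> verts H. card {v \<in> verts G. f v = w} = 2)"

definition graph_iso :: "('a \<Rightarrow> 'b) \<Rightarrow> 'a ugraph \<Rightarrow> 'b ugraph \<Rightarrow> bool" where
  "graph_iso f G H \<longleftrightarrow> bij_betw f (verts G) (verts H) \<and>
     (\<forall>u \<in> verts G. \<forall>v \<in> verts G. {u, v} \<in> edges G \<longleftrightarrow> {f u, f v} \<in> edges H)"

definition map_graph :: "('a \<Rightarrow> 'b) \<Rightarrow> 'a ugraph \<Rightarrow> 'b ugraph" where
  "map_graph f G = \<lparr> verts = f ` verts G, edges = (\<lambda>e. f ` e) ` edges G \<rparr>"

definition graph_Union :: "'a ugraph set \<Rightarrow> 'a ugraph" where
  "graph_Union \<G> = \<lparr> verts = (\<Union>G \<in> \<G>. verts G), edges = (\<Union>G \<in> \<G>. edges G) \<rparr>"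

text \<open>The disjoint union of \<open>n\<close> copies of \<open>G\<close>; the copies are numbered \<open>0, \<dots>, n - 1\<close>.\<close>

definition copies :: "nat \<Rightarrow> 'a ugraph \<Rightarrow> (nat \<times> 'a) ugraph" where
  "copies n G = \<lparr> verts = {..<n} \<times> verts G, edges = {Pair k ` e | k e. k < n \<and> e \<in> edges G} \<rparr>"

definition box_prod :: "'a ugraph \<Rightarrow> 'b ugraph \<Rightarrow> ('a \<times> 'b) ugraph" (infixr "\<box>" 70) where
  "G \<box> H = \<lparr> verts = verts G \<times> verts H,
     edges = {{(a, b), (a', b)} | a a' b. {a, a'} \<in> edges G \<and> b \<in> verts H} \<union>
             {{(a, b), (a, b')} | a b b'. a \<in> verts G \<and> {b, b'} \<in> edges H} \<rparr>"

text \<open>An orientation is given by its set of arcs.\<close>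

definition orientation :: "('a \<times> 'a) set \<Rightarrow> 'a ugraph \<Rightarrow> bool" where
  "orientation D G \<longleftrightarrow> bij_betw (\<lambda>(u, v). {u, v}) D (edges G)"

definition copies_arcs :: "nat \<Rightarrow> ('a \<times> 'a) set \<Rightarrow> ((nat \<times> 'a) \<times> (nat \<times> 'a)) set" where
  "copies_arcs n D = {((k, u), (k, v)) | k u v. k < n \<and> (u, v) \<in> D}"

definition compatible :: "('a \<Rightarrow> 'b) \<Rightarrow> ('a \<times> 'a) set \<Rightarrow> ('b \<times> 'b) set \<Rightarrow> bool" where
  "compatible f D D' \<longleftrightarrow> (\<forall>(u, w) \<in> D. (f u, f w) \<in> D')"


section \<open>Cycles and sunlets\<close>

text \<open>Residues modulo \<open>m\<close> are represented by \<open>0, \<dots>, m - 1\<close>. For \<open>m < 3\<close> the following is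
  not a cycle (for \<open>m = 1\<close> not even a simple graph).\<close>

definition cycle_graph :: "nat \<Rightarrow> nat ugraph" where
  "cycle_graph m = \<lparr> verts = {..<m}, edges = {{i, (i + 1) mod m} | i. i < m} \<rparr>"

definition is_cycle_of :: "'a ugraph \<Rightarrow> 'a ugraph \<Rightarrow> bool" where
  "is_cycle_of Z G \<longleftrightarrow> subgraph Z G \<and> (\<exists>m \<ge> 3. \<exists>f. graph_iso f (cycle_graph m) Z)"

text \<open>The unique cycle of a unicyclic graph; it is computed for sunlets in
  \<open>unique_cycle_sunlet\<close> below.\<close>

definition unique_cycle :: "'a ugraph \<Rightarrow> 'a ugraph" where
  "unique_cycle G = (THE Z. is_cycle_of Z G)"

datatype sunlet_vertex = Rim nat | Leaf nat

definition sunlet :: "nat \<Rightarrow> sunlet_vertex ugraph" where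
  "sunlet p = \<lparr> verts = Rim ` {..<p} \<union> Leaf ` {..<p},
     edges = {{Rim i, Rim ((i + 1) mod p)} | i. i < p} \<union> {{Leaf i, Rim i} | i. i < p} \<rparr>"

text \<open>Of the two directions of the rim we take the one of increasing index; the reflection
  \<open>i \<mapsto> -i\<close> of the sunlet exchanges them.\<close>

definition FSM_orientation :: "nat \<Rightarrow> (sunlet_vertex \<times> sunlet_vertex) set" where
  "FSM_orientation p =
     {(Rim i, Rim ((i + 1) mod p)) | i. i < p} \<union> {(Leaf i, Rim i) | i. i < p}"


section \<open>The torus grid and its staircases\<close>

definition standard_orientation :: "nat \<Rightarrow> ((nat \<times> nat) \<times> (nat \<times> nat)) set" where
  "standard_orientation m =
     {((a, b), ((a + 1) mod m, b)) | a b. a < m \<and> b < m} \<union>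
     {((a, b), (a, (b + 1) mod m)) | a b. a < m \<and> b < m}"

text \<open>The cyclic sequence \<open>(0,0), (1,0), (1,1), (2,1), (2,2), \<dots>, (2n-1,2n-1), (0,2n-1)\<close>,
  for indices \<open>j < 4n\<close>.\<close>

definition stair_seq :: "nat \<Rightarrow> nat \<Rightarrow> nat \<times> nat" where
  "stair_seq n j = (((j + 1) div 2) mod (2 * n), (j div 2) mod (2 * n))"

definition staircase :: "nat \<Rightarrow> nat \<Rightarrow> (nat \<times> nat) ugraph" where
  "staircase n k = map_graph (\<lambda>(a, b). ((a + 2 * k) mod (2 * n), b))
                     (map_graph (stair_seq n) (cycle_graph (4 * n)))"


section \<open>Sanity checks\<close>

lemma Suc_mod_neq: "Suc i mod m \<noteq> i" if "m \<ge> 2" "i < m"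
  using that by (cases "Suc i = m") auto

lemma Suc_Suc_mod_neq: "Suc (Suc i mod m) mod m \<noteq> i" if "m \<ge> 3" "i < m"
  using that by (cases "Suc i = m"; cases "Suc (Suc i) = m") auto

lemma Suc_mod_inj: "i = j" if "Suc i mod m = Suc j mod m" "i < m" "j < m"
  using that by (cases "Suc i = m"; cases "Suc j = m") auto

lemma Suc_mod_pred: "\<exists>k < m. Suc k mod m = i" if "i < (m::nat)"
proof (cases i)
  case 0
  then show ?thesis using that by (intro exI[of _ "m - 1"]) auto
next
  case (Suc j)
  then show ?thesis using that by (intro exI[of _ j]) auto
qed

lemma simple_graph_cycle_graph: "m \<ge> 2 \<Longrightarrow> simple_graph (cycle_graph m)"
  by (auto simp: simple_graph_def cycle_graph_def card_insert_if dest: Suc_mod_neq[rotated])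

lemma simple_graph_sunlet: "p \<ge> 2 \<Longrightarrow> simple_graph (sunlet p)"
  by (auto simp: simple_graph_def sunlet_def card_insert_if dest: Suc_mod_neq[rotated])

lemma cycle_graph_two_neighbours:
  assumes "m \<ge> 3" "i < m"
  shows "\<exists>a < m. \<exists>b < m. a \<noteq> b \<and> {i, a} \<in> edges (cycle_graph m) \<and> {i, b} \<in> edges (cycle_graph m)"
proof -
  obtain k where k: "k < m" "Suc k mod m = i" using Suc_mod_pred assms by blast
  have "{i, k} = {k, Suc k mod m}" using k by auto
  moreover have "Suc i mod m \<noteq> k" using Suc_Suc_mod_neq[of m k] k assms by auto
  ultimately show ?thesis using k assms
    by (intro exI[of _ "Suc i mod m"] exI[of _ k] conjI) (auto simp: cycle_graph_def)
qed

definition sunlet_rim :: "nat \<Rightarrow> sunlet_vertex ugraph" where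
  "sunlet_rim p = map_graph Rim (cycle_graph p)"

lemma verts_sunlet_rim: "verts (sunlet_rim p) = Rim ` {..<p}"
  by (simp add: sunlet_rim_def map_graph_def cycle_graph_def)

lemma edges_sunlet_rim: "edges (sunlet_rim p) = {{Rim i, Rim ((i + 1) mod p)} | i. i < p}"
  by (simp add: sunlet_rim_def map_graph_def cycle_graph_def setcompr_eq_image image_image)

lemma sunlet_rim_is_cycle: "is_cycle_of (sunlet_rim p) (sunlet p)" if "p \<ge> 3"
proof -
  have inj: "inj Rim" by (auto intro: injI)
  have "graph_iso Rim (cycle_graph p) (sunlet_rim p)"
    unfolding graph_iso_def
  proof (intro conjI ballI)
    show "bij_betw Rim (verts (cycle_graph p)) (verts (sunlet_rim p))"
      by (auto simp: sunlet_rim_def map_graph_def bij_betw_def inj_on_def)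
    fix u v
    have "{u, v} \<in> edges (cycle_graph p) \<longleftrightarrow> Rim ` {u, v} \<in> edges (sunlet_rim p)"
    proof
      assume "Rim ` {u, v} \<in> edges (sunlet_rim p)"
      then obtain e where "e \<in> edges (cycle_graph p)" "Rim ` {u, v} = Rim ` e"
        by (auto simp: sunlet_rim_def map_graph_def)
      then show "{u, v} \<in> edges (cycle_graph p)"
        using inj_image_eq_iff[OF inj, of "{u, v}" e] by (simp only:)
    next
      assume "{u, v} \<in> edges (cycle_graph p)"
      then show "Rim ` {u, v} \<in> edges (sunlet_rim p)"
        by (simp only: sunlet_rim_def map_graph_def ugraph.simps imageI)
    qed
    then show "{u, v} \<in> edges (cycle_graph p) \<longleftrightarrow> {Rim u, Rim v} \<in> edges (sunlet_rim p)"
      by simp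
  qed
  moreover have "subgraph (sunlet_rim p) (sunlet p)"
    using that
    by (auto simp: subgraph_def simple_graph_def sunlet_def sunlet_rim_def cycle_graph_def
        map_graph_def card_insert_if dest: Suc_mod_neq[rotated])
  ultimately show ?thesis using that by (auto simp: is_cycle_of_def)
qed

lemma is_cycle_of_sunlet_unique:
  assumes p: "p \<ge> 3" and Z: "is_cycle_of Z (sunlet p)"
  shows "Z = sunlet_rim p"
proof -
  obtain m f where m: "m \<ge> 3" and f: "graph_iso f (cycle_graph m) Z"
    using Z by (auto simp: is_cycle_of_def)
  have sub: "verts Z \<subseteq> verts (sunlet p)" "edges Z \<subseteq> edges (sunlet p)" "simple_graph Z"
    using Z by (auto simp: is_cycle_of_def subgraph_def)
  have two: "\<exists>a \<in> verts Z. \<exists>b \<in> verts Z. a \<noteq> b \<and> {v, a} \<in> edges Z \<and> {v, b} \<in> edges Z"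
    if v: "v \<in> verts Z" for v
  proof -
    have V: "verts (cycle_graph m) = {..<m}" by (simp add: cycle_graph_def)
    have bij: "bij_betw f {..<m} (verts Z)" using f V by (simp add: graph_iso_def)
    then obtain i where i: "i < m" "v = f i" using v by (auto simp: bij_betw_def)
    obtain a b where ab: "a < m" "b < m" "a \<noteq> b"
      "{i, a} \<in> edges (cycle_graph m)" "{i, b} \<in> edges (cycle_graph m)"
      using cycle_graph_two_neighbours[OF m i(1)] by blast
    have "f a \<noteq> f b" using bij ab by (auto simp: bij_betw_def inj_on_def)
    moreover have "{f i, f a} \<in> edges Z" "{f i, f b} \<in> edges Z"
      using f ab i V by (auto simp: graph_iso_def)
    moreover have "f a \<in> verts Z" "f b \<in> verts Z" using bij ab by (auto simp: bij_betw_def)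
    ultimately show ?thesis using i by blast
  qed
  have no_leaf: "Leaf i \<notin> verts Z" for i
  proof
    assume "Leaf i \<in> verts Z"
    then obtain a b where "a \<noteq> b" "{Leaf i, a} \<in> edges (sunlet p)" "{Leaf i, b} \<in> edges (sunlet p)"
      using two sub by blast
    then show False by (auto simp: sunlet_def doubleton_eq_iff)
  qed
  have edges_Z: "edges Z \<subseteq> edges (sunlet_rim p)"
  proof
    fix e assume e: "e \<in> edges Z"
    then have "e \<subseteq> verts Z" using sub by (auto simp: simple_graph_def)
    then have "Leaf i \<notin> e" for i using no_leaf by auto
    moreover have "e \<in> edges (sunlet p)" using e sub by auto
    ultimately show "e \<in> edges (sunlet_rim p)"
      by (auto simp: sunlet_def edges_sunlet_rim)
  qed
  have next_edge: "{Rim i, Rim (Suc i mod p)} \<in> edges Z" if ri: "Rim i \<in> verts Z" for i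
  proof -
    obtain a b where ab: "a \<noteq> b" "{Rim i, a} \<in> edges Z" "{Rim i, b} \<in> edges Z"
      using two[OF ri] by blast
    have nb: "c = Rim (Suc i mod p) \<or> (\<exists>k < p. c = Rim k \<and> Suc k mod p = i)"
      if "{Rim i, c} \<in> edges Z" for c
    proof -
      have "{Rim i, c} \<in> edges (sunlet_rim p)" using that edges_Z by auto
      then show ?thesis
        by (auto simp: edges_sunlet_rim doubleton_eq_iff)
    qed
    show ?thesis
    proof (cases "a = Rim (Suc i mod p) \<or> b = Rim (Suc i mod p)")
      case True then show ?thesis using ab by auto
    next
      case False
      then have "a = b" using nb[OF ab(2)] nb[OF ab(3)] Suc_mod_inj by metis
      then show ?thesis using ab by simp
    qed
  qed
  have "verts Z = f ` {..<m}"
    using f by (simp add: graph_iso_def cycle_graph_def bij_betw_def)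
  then have "f 0 \<in> verts Z" using m by simp
  then obtain i0 where i0: "Rim i0 \<in> verts Z" "i0 < p"
    using no_leaf sub by (force simp: sunlet_def)
  have "Rim ((i0 + j) mod p) \<in> verts Z" for j
  proof (induction j)
    case 0 then show ?case using i0 by simp
  next
    case (Suc j)
    have "{Rim ((i0 + j) mod p), Rim (Suc ((i0 + j) mod p) mod p)} \<subseteq> verts Z"
      using next_edge[OF Suc] sub by (auto simp: simple_graph_def)
    then show ?case by (simp add: mod_Suc_eq)
  qed
  note reach = this
  have all: "Rim i \<in> verts Z" if "i < p" for i
  proof -
    have "(i0 + (p - i0 + i)) mod p = i" using that i0 by simp
    then show ?thesis using reach by metis
  qed
  have vZ: "verts Z = verts (sunlet_rim p)"
  proof
    show "verts Z \<subseteq> verts (sunlet_rim p)"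
      using sub no_leaf by (auto simp: sunlet_def verts_sunlet_rim)
    show "verts (sunlet_rim p) \<subseteq> verts Z"
      using all by (auto simp: verts_sunlet_rim)
  qed
  have "edges (sunlet_rim p) \<subseteq> edges Z"
    using all next_edge by (auto simp: edges_sunlet_rim)
  then have "edges Z = edges (sunlet_rim p)" using edges_Z by auto
  with vZ show ?thesis by simp
qed

theorem unique_cycle_sunlet: "unique_cycle (sunlet p) = sunlet_rim p" if "p \<ge> 3"
  unfolding unique_cycle_def
  using sunlet_rim_is_cycle[OF that] is_cycle_of_sunlet_unique[OF that] by (rule the_equality)

lemma orientation_FSM: "orientation (FSM_orientation p) (sunlet p)" if "p \<ge> 3"
  unfolding orientation_def bij_betw_def
proof
  have *: "i = j" if "i < p" "j < p" "i = Suc j mod p" "Suc i mod p = j" for i j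
    using Suc_Suc_mod_neq[of p j] \<open>p \<ge> 3\<close> that by auto
  show "inj_on (\<lambda>(u, v). {u, v}) (FSM_orientation p)"
    by (auto simp: inj_on_def FSM_orientation_def doubleton_eq_iff dest: * )
  show "(\<lambda>(u, v). {u, v}) ` FSM_orientation p = edges (sunlet p)"
    by (simp add: FSM_orientation_def sunlet_def image_Un setcompr_eq_image image_image)
qed

lemma verts_torus: "verts (cycle_graph m \<box> cycle_graph m) = {..<m} \<times> {..<m}"
  by (simp add: box_prod_def cycle_graph_def)

lemma verts_cycle_graph: "verts (cycle_graph m) = {..<m}"
  by (simp add: cycle_graph_def)

lemma in_edges_cycle_graph: "i < m \<Longrightarrow> {i, Suc i mod m} \<in> edges (cycle_graph m)"
  by (auto simp: cycle_graph_def)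

lemma box_prod_edge1: "{a, a'} \<in> edges G \<Longrightarrow> b \<in> verts H \<Longrightarrow> {(a, b), (a', b)} \<in> edges (G \<box> H)"
  unfolding box_prod_def by simp blast

lemma box_prod_edge2: "a \<in> verts G \<Longrightarrow> {b, b'} \<in> edges H \<Longrightarrow> {(a, b), (a, b')} \<in> edges (G \<box> H)"
  unfolding box_prod_def by simp blast

lemma orientation_standard:
  "orientation (standard_orientation m) (cycle_graph m \<box> cycle_graph m)" if "m \<ge> 3"
  unfolding orientation_def bij_betw_def
proof
  have *: False if "i < m" "Suc (Suc i mod m) mod m = i" for i
    using Suc_Suc_mod_neq[of m i] \<open>m \<ge> 3\<close> that by auto
  have **: False if "i < m" "Suc i mod m = i" for i
    using Suc_mod_neq[of m i] \<open>m \<ge> 3\<close> that by auto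
  have "(v, u) \<notin> standard_orientation m" if "(u, v) \<in> standard_orientation m" for u v
    using that * ** by (auto simp: standard_orientation_def)
  then show "inj_on (\<lambda>(u, v). {u, v}) (standard_orientation m)"
    by (auto simp: inj_on_def doubleton_eq_iff simp del: split_paired_All)
  show "(\<lambda>(u, v). {u, v}) ` standard_orientation m = edges (cycle_graph m \<box> cycle_graph m)"
    (is "?L = ?R")
  proof
    show "?L \<subseteq> ?R"
    proof
      fix e assume "e \<in> ?L"
      then consider (h) a b where "e = {(a, b), (Suc a mod m, b)}" "a < m" "b < m"
        | (v) a b where "e = {(a, b), (a, Suc b mod m)}" "a < m" "b < m"
        by (auto simp: standard_orientation_def)
      then show "e \<in> ?R"
      proof cases
        case h
        then show ?thesis
          using in_edges_cycle_graph[of a m] by (auto intro: box_prod_edge1 simp: verts_cycle_graph)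
      next
        case v
        then show ?thesis
          using in_edges_cycle_graph[of b m] by (auto intro: box_prod_edge2 simp: verts_cycle_graph)
      qed
    qed
    show "?R \<subseteq> ?L"
    proof
      fix e assume "e \<in> ?R"
      then consider (h) a a' b i where "e = {(a, b), (a', b)}" "{a, a'} = {i, Suc i mod m}" "i < m" "b < m"
        | (v) a b b' i where "e = {(a, b), (a, b')}" "{b, b'} = {i, Suc i mod m}" "i < m" "a < m"
      proof -
        assume R: "e \<in> ?R"
          and h: "\<And>a b a' i. e = {(a, b), (a', b)} \<Longrightarrow> {a, a'} = {i, Suc i mod m} \<Longrightarrow>
            i < m \<Longrightarrow> b < m \<Longrightarrow> thesis"
          and v: "\<And>a b b' i. e = {(a, b), (a, b')} \<Longrightarrow> {b, b'} = {i, Suc i mod m} \<Longrightarrow>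
            i < m \<Longrightarrow> a < m \<Longrightarrow> thesis"
        from R show thesis
          unfolding box_prod_def cycle_graph_def using h v by simp blast
      qed
      then show "e \<in> ?L"
      proof cases
        case h
        then have "e = {(i, b), (Suc i mod m, b)}" by (auto simp: doubleton_eq_iff)
        then show ?thesis using h
          by (auto simp: standard_orientation_def image_iff
              intro!: bexI[of _ "((i, b), (Suc i mod m, b))"])
      next
        case v
        then have "e = {(a, i), (a, Suc i mod m)}" by (auto simp: doubleton_eq_iff)
        then show ?thesis using v
          by (auto simp: standard_orientation_def image_iff
              intro!: bexI[of _ "((a, i), (a, Suc i mod m))"])
      qed
    qed
  qed
qed

lemma stair_seq_even: "i < 2 * n \<Longrightarrow> stair_seq n (2 * i) = (i, i)"
  and stair_seq_odd: "i < 2 * n \<Longrightarrow> stair_seq n (2 * i + 1) = ((i + 1) mod (2 * n), i)"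
  by (auto simp: stair_seq_def)

end

theory Submission
  imports Defs
begin

text \<open>A vertex \<open>(a, b)\<close> of the torus lies on exactly one staircase, namely \<open>T\<^sub>k\<close> with
  \<open>k = ((a - b) mod 2n) div 2\<close>. The staircase leaves \<open>(a, b)\<close> horizontally if \<open>a + b\<close> is
  even and vertically otherwise, and it enters \<open>(a, b)\<close> vertically if \<open>a + b\<close> is even and
  horizontally otherwise. So every vertex has exactly one incoming and one outgoing arc off the
  staircases. Sending the leaf at a rim vertex to the tail of the incoming one uses each of these
  arcs once and hits every vertex once. Surjectivity on arcs is read off directly; bijectivity
  follows by counting, as both sides have \<open>8n\<^sup>2\<close> arcs.\<close>

section \<open>Orientations, copies and isomorphisms\<close>

text \<open>Forgetting directions is a bijection from arcs to edges on both sides and commutes with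
  the map induced by \<open>f\<close>. Bijectivity on edges can thus be checked on arcs, where the
  two ends are distinguishable.\<close>

lemma covering_if_bij_betw_arcs:
  assumes D: "orientation D G" and D': "orientation D' H"
    and f: "bij_betw (map_prod f f) D D'" and verts: "f ` verts G \<subseteq> verts H"
  shows "covering f G H"
proof -
  let ?e = "\<lambda>(u, v). {u, v}" and ?e' = "\<lambda>(u, v). {u, v}"
  have "bij_betw (?e' \<circ> map_prod f f) D (edges H)"
    using f D' unfolding orientation_def by (rule bij_betw_trans)
  moreover have "?e' \<circ> map_prod f f = (\<lambda>e. f ` e) \<circ> ?e"
    by (auto simp: fun_eq_iff)
  ultimately have "bij_betw ((\<lambda>e. f ` e) \<circ> ?e) D (edges H)"
    by simp
  then have "bij_betw (\<lambda>e. f ` e) (edges G) (edges H)"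
    using bij_betw_comp_iff[of ?e D "edges G" "\<lambda>e. f ` e" "edges H"] D
    by (simp add: orientation_def)
  then show ?thesis
    using verts by (auto simp: covering_def graph_hom_def bij_betw_def)
qed

lemma orientation_copies:
  assumes "orientation D G"
  shows "orientation (copies_arcs n D) (copies n G)"
  unfolding orientation_def bij_betw_def
proof
  have inj: "u = u' \<and> v = v'" if "{u, v} = {u', v'}" "(u, v) \<in> D" "(u', v') \<in> D" for u v u' v'
    using assms that by (fastforce simp: orientation_def bij_betw_def inj_on_def)
  show "inj_on (\<lambda>(u, v). {u, v}) (copies_arcs n D)"
  proof (rule inj_onI)
    fix x y
    assume "x \<in> copies_arcs n D" "y \<in> copies_arcs n D"
      and eq: "(\<lambda>(u, v). {u, v}) x = (\<lambda>(u, v). {u, v}) y"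
    then obtain k u v l u' v' where
      xy: "x = ((k, u), (k, v))" "(u, v) \<in> D" "y = ((l, u'), (l, v'))" "(u', v') \<in> D"
      by (auto simp: copies_arcs_def)
    \<comment> \<open>Both ends of an edge carry the number of its copy, so the edge determines the
      copy.\<close>
    have "k = l" "{u, v} = {u', v'}"
      using eq xy by (auto simp: doubleton_eq_iff)
    then show "x = y"
      using inj[of u v u' v'] xy by simp
  qed
  have edges: "edges G = (\<lambda>(u, v). {u, v}) ` D"
    using assms by (simp add: orientation_def bij_betw_def)
  show "(\<lambda>(u, v). {u, v}) ` copies_arcs n D = edges (copies n G)"
  proof
    show "(\<lambda>(u, v). {u, v}) ` copies_arcs n D \<subseteq> edges (copies n G)"
    proof
      fix e assume "e \<in> (\<lambda>(u, v). {u, v}) ` copies_arcs n D"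
      then obtain k u v where "e = Pair k ` {u, v}" "k < n" "(u, v) \<in> D"
        by (auto simp: copies_arcs_def)
      moreover from this have "{u, v} \<in> edges G"
        unfolding edges by (intro rev_image_eqI[of "(u, v)"]) simp_all
      ultimately show "e \<in> edges (copies n G)"
        unfolding copies_def ugraph.simps by blast
    qed
    show "edges (copies n G) \<subseteq> (\<lambda>(u, v). {u, v}) ` copies_arcs n D"
    proof
      fix e assume "e \<in> edges (copies n G)"
      then obtain k u v where "e = Pair k ` {u, v}" "k < n" "(u, v) \<in> D"
        by (auto simp: copies_def edges)
      then show "e \<in> (\<lambda>(u, v). {u, v}) ` copies_arcs n D"
        by (intro rev_image_eqI[of "((k, u), (k, v))"]) (auto simp: copies_arcs_def)
    qed
  qed
qed

text \<open>Since \<open>f\<close> is injective on \<open>verts G\<close> only, an edge is recovered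
  from its image because it lies inside \<open>verts G\<close>.\<close>

lemma graph_iso_map_graph:
  assumes inj: "inj_on f (verts G)" and edges: "\<And>e. e \<in> edges G \<Longrightarrow> e \<subseteq> verts G"
  shows "graph_iso f G (map_graph f G)"
  unfolding graph_iso_def
proof (intro conjI ballI)
  show "bij_betw f (verts G) (verts (map_graph f G))"
    using inj by (simp add: map_graph_def bij_betw_def)
  fix u v assume uv: "u \<in> verts G" "v \<in> verts G"
  show "{u, v} \<in> edges G \<longleftrightarrow> {f u, f v} \<in> edges (map_graph f G)"
  proof
    assume "{u, v} \<in> edges G"
    then show "{f u, f v} \<in> edges (map_graph f G)"
      unfolding map_graph_def ugraph.simps by (rule rev_image_eqI) simp
  next
    assume "{f u, f v} \<in> edges (map_graph f G)"
    then obtain e where e: "e \<in> edges G" "f ` e = f ` {u, v}"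
      by (auto simp: map_graph_def)
    then have "e = {u, v}"
      using inj_on_image_eq_iff[OF inj, of e "{u, v}"] edges uv by simp
    then show "{u, v} \<in> edges G"
      using e by simp
  qed
qed

lemma map_graph_copies:
  "map_graph f (copies n G) = graph_Union ((\<lambda>k. map_graph (\<lambda>v. f (k, v)) G) ` {..<n})"
  by (auto simp: map_graph_def copies_def graph_Union_def image_image image_iff)

lemma map_graph_map_graph: "map_graph f (map_graph g G) = map_graph (\<lambda>v. f (g v)) G"
  by (simp add: map_graph_def image_image)

section \<open>Counting arcs\<close>

lemma copies_arcs_eq: "copies_arcs n D = (\<lambda>(k, u, v). ((k, u), (k, v))) ` ({..<n} \<times> D)"
  by (force simp: copies_arcs_def)

lemma card_copies_arcs: "card (copies_arcs n D) = n * card D"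
  unfolding copies_arcs_eq
  by (subst card_image) (auto simp: inj_on_def card_cartesian_product)

lemma finite_copies_arcs: "finite D \<Longrightarrow> finite (copies_arcs n D)"
  by (simp add: copies_arcs_eq)

lemma finite_FSM_orientation: "finite (FSM_orientation p)"
  by (simp add: FSM_orientation_def)

lemma card_FSM_orientation: "card (FSM_orientation p) = 2 * p"
proof -
  let ?r = "\<lambda>i. (Rim i, Rim ((i + 1) mod p))" and ?l = "\<lambda>i. (Leaf i, Rim i)"
  have "FSM_orientation p = ?r ` {..<p} \<union> ?l ` {..<p}"
    by (auto simp: FSM_orientation_def)
  moreover have "card (?r ` {..<p}) = p"
    by (simp add: card_image inj_on_def)
  moreover have "card (?l ` {..<p}) = p"
    by (simp add: card_image inj_on_def)
  moreover have "?r ` {..<p} \<inter> ?l ` {..<p} = {}"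
    by auto
  ultimately show ?thesis
    by (simp add: card_Un_disjoint)
qed

lemma card_standard_orientation:
  assumes "m \<ge> 2"
  shows "card (standard_orientation m) = 2 * m * m"
proof -
  let ?h = "\<lambda>(a, b). ((a, b), ((a + 1) mod m, b))" and ?v = "\<lambda>(a, b). ((a, b), (a, (b + 1) mod m))"
  have "standard_orientation m = ?h ` ({..<m} \<times> {..<m}) \<union> ?v ` ({..<m} \<times> {..<m})"
    by (auto simp: standard_orientation_def)
  moreover have "card (?h ` ({..<m} \<times> {..<m})) = m * m"
    by (subst card_image) (auto simp: inj_on_def card_cartesian_product)
  moreover have "card (?v ` ({..<m} \<times> {..<m})) = m * m"
    by (subst card_image) (auto simp: inj_on_def card_cartesian_product)
  \<comment> \<open>A common arc would be a loop, hence a residue equal to its own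
    successor.\<close>
  moreover have "?h ` ({..<m} \<times> {..<m}) \<inter> ?v ` ({..<m} \<times> {..<m}) = {}"
    using Suc_mod_neq[OF assms] by auto
  ultimately show ?thesis
    by (simp add: card_Un_disjoint)
qed

section \<open>The covering map\<close>

text \<open>The vertex of index \<open>j\<close> on the staircase \<open>T_k\<close>, with a single
  reduction per coordinate. Indices beyond \<open>4 * n\<close> are allowed, so that a step can be
  written with \<open>Suc j\<close>.\<close>

definition stair_pos :: "nat \<Rightarrow> nat \<Rightarrow> nat \<Rightarrow> nat \<times> nat" where
  "stair_pos n k j = (((j + 1) div 2 + 2 * k) mod (2 * n), (j div 2) mod (2 * n))"

text \<open>Adding \<open>2n - 1\<close> is subtracting \<open>1\<close> modulo \<open>2n\<close>.\<close>

definition pend_pos :: "nat \<Rightarrow> nat \<Rightarrow> nat \<Rightarrow> nat \<times> nat" where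
  "pend_pos n k j = (case stair_pos n k j of (a, b) \<Rightarrow>
     if even j then ((a + (2 * n - 1)) mod (2 * n), b) else (a, (b + (2 * n - 1)) mod (2 * n)))"

fun stair_cover :: "nat \<Rightarrow> nat \<times> sunlet_vertex \<Rightarrow> nat \<times> nat" where
  "stair_cover n (k, Rim j) = stair_pos n k j"
| "stair_cover n (k, Leaf j) = pend_pos n k j"

section \<open>Residues, parity and steps along a staircase\<close>

lemma Suc_pred_mod: "a < m \<Longrightarrow> Suc ((a + (m - 1)) mod m) mod m = a"
  by (simp add: mod_Suc_eq)

lemma pred_Suc_mod: "a < m \<Longrightarrow> (Suc a mod m + (m - 1)) mod m = a"
  by (cases "Suc a = m") auto

lemma even_Suc_mod: "even m \<Longrightarrow> even (Suc a mod m) \<longleftrightarrow> odd a"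
  by (simp add: dvd_mod_iff)

lemma stair_pos_less: "n > 0 \<Longrightarrow> stair_pos n k j \<in> {..<2 * n} \<times> {..<2 * n}"
  by (simp add: stair_pos_def)

lemma pend_pos_less: "n > 0 \<Longrightarrow> pend_pos n k j \<in> {..<2 * n} \<times> {..<2 * n}"
  using stair_pos_less[of n k j] by (auto simp: pend_pos_def)

text \<open>The staircase closes up: at index \<open>4 * n\<close> both coordinates have advanced by
  \<open>2 * n\<close>, one full turn.\<close>

lemma stair_pos_mod: "stair_pos n k (Suc j mod (4 * n)) = stair_pos n k (Suc j)" if "j < 4 * n"
proof (cases "Suc j = 4 * n")
  case True
  then have "stair_pos n k (Suc j) = stair_pos n k (4 * n)"
    by simp
  also have "\<dots> = stair_pos n k 0"
    by (simp add: stair_pos_def)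
  finally show ?thesis
    using True by simp
qed (use that in simp)

text \<open>Passing from \<open>j\<close> to \<open>Suc j\<close> raises
  \<open>(j + 1) div 2\<close> if \<open>j\<close> is even and \<open>j div 2\<close> if
  \<open>j\<close> is odd, and leaves the other one fixed.\<close>

lemma stair_pos_Suc:
  assumes "stair_pos n k j = (a, b)"
  shows "stair_pos n k (Suc j) =
    (if even j then (Suc a mod (2 * n), b) else (a, Suc b mod (2 * n)))"
  using assms by (auto simp: stair_pos_def mod_Suc_eq elim!: evenE oddE)

text \<open>The two halves of \<open>j\<close> add up to \<open>j\<close>; the shift
  \<open>2 * k\<close> and reduction modulo \<open>2 * n\<close> preserve parity. Hence the vertex
  alone tells in which direction its staircase continues.\<close>

lemma even_stair_pos:
  assumes "stair_pos n k j = (a, b)"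
  shows "even (a + b) \<longleftrightarrow> even j"
proof -
  have par: "even (x mod (2 * n)) \<longleftrightarrow> even x" for x
    by (simp add: dvd_mod_iff)
  have ab: "a = ((j + 1) div 2 + 2 * k) mod (2 * n)" "b = (j div 2) mod (2 * n)"
    using assms by (simp_all add: stair_pos_def)
  have "even (a + b) \<longleftrightarrow> even ((j + 1) div 2 + 2 * k + j div 2)"
    by (simp only: ab even_add par)
  also have "(j + 1) div 2 + 2 * k + j div 2 = j + 2 * k"
    by presburger
  finally show ?thesis
    by simp
qed

section \<open>Reaching every vertex and every arc\<close>

lemma stair_pos_surj:
  assumes "a < 2 * n" "b < 2 * n"
  obtains k j where "k < n" "j < 4 * n" "stair_pos n k j = (a, b)"
proof
  \<comment> \<open>\<open>d\<close> is a - b modulo 2n. At index \<open>j\<close> of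
    \<open>T_k\<close> this difference is \<open>2 * k + j mod 2\<close>, so \<open>d div 2\<close>
    is the staircase and \<open>d mod 2\<close> the parity of \<open>j\<close>; together with
    \<open>j div 2 = b\<close> this gives \<open>j = 2 * b + d mod 2\<close>.\<close>
  define d where "d = (a + (2 * n - b)) mod (2 * n)"
  have d: "d < 2 * n" "(b + d) mod (2 * n) = a"
    using assms by (simp_all add: d_def mod_add_right_eq)
  show "d div 2 < n" "2 * b + d mod 2 < 4 * n"
    using d assms by auto
  have "(2 * b + d mod 2 + 1) div 2 + 2 * (d div 2) = b + d"
    by presburger
  then show "stair_pos n (d div 2) (2 * b + d mod 2) = (a, b)"
    using d assms by (simp add: stair_pos_def)
qed

lemma stair_arc_cases:
  assumes "a < 2 * n" "b < 2 * n"
  obtains k j where "k < n" "j < 4 * n" "stair_pos n k j = (a, b)"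
    "stair_pos n k (Suc j) = (if even (a + b) then (Suc a mod (2 * n), b) else (a, Suc b mod (2 * n)))"
proof -
  obtain k j where kj: "k < n" "j < 4 * n" "stair_pos n k j = (a, b)"
    using stair_pos_surj[OF assms] .
  then show ?thesis
    using that stair_pos_Suc[OF kj(3)] even_stair_pos[OF kj(3)] by simp
qed

text \<open>The copy and index are those of the head of the arc leaving \<open>(a, b)\<close> off
  its staircase. The parity of the head makes \<open>pend_pos\<close> step back along that same
  arc.\<close>

lemma pend_arc_cases:
  assumes "a < 2 * n" "b < 2 * n"
  obtains k j where "k < n" "j < 4 * n" "pend_pos n k j = (a, b)"
    "stair_pos n k j = (if even (a + b) then (a, Suc b mod (2 * n)) else (Suc a mod (2 * n), b))"
proof (cases "even (a + b)")
  case True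
  obtain k j where kj: "k < n" "j < 4 * n" "stair_pos n k j = (a, Suc b mod (2 * n))"
    using stair_pos_surj[of a n "Suc b mod (2 * n)"] assms by auto
  moreover have "odd j"
    using even_stair_pos[OF kj(3)] True by (simp add: even_Suc_mod)
  then have "pend_pos n k j = (a, b)"
    using kj assms pred_Suc_mod[of b "2 * n"] by (simp add: pend_pos_def)
  ultimately show ?thesis
    using that True by simp
next
  case False
  obtain k j where kj: "k < n" "j < 4 * n" "stair_pos n k j = (Suc a mod (2 * n), b)"
    using stair_pos_surj[of "Suc a mod (2 * n)" n b] assms by auto
  moreover have "even j"
    using even_stair_pos[OF kj(3)] False by (simp add: even_Suc_mod)
  then have "pend_pos n k j = (a, b)"
    using kj assms pred_Suc_mod[of a "2 * n"] by (simp add: pend_pos_def)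
  ultimately show ?thesis
    using that False by simp
qed

section \<open>Bijectivity on vertices by counting\<close>

lemma bij_betw_if_surj_card:
  assumes "finite A" "card A = card B" "f ` A = B"
  shows "bij_betw f A B"
  using assms by (simp add: bij_betw_def eq_card_imp_inj_on)

text \<open>Both sides have 4n^2 elements, so surjectivity suffices. The map is arbitrary because
  the lemma serves both rim vertices and leaves.\<close>

lemma bij_betw_torus:
  fixes f :: "nat \<Rightarrow> nat \<Rightarrow> nat \<times> nat"
  assumes less: "\<And>k j. f k j \<in> {..<2 * n} \<times> {..<2 * n}"
    and surj: "\<And>a b. a < 2 * n \<Longrightarrow> b < 2 * n \<Longrightarrow> \<exists>k<n. \<exists>j<4 * n. f k j = (a, b)"
  shows "bij_betw (\<lambda>(k, j). f k j) ({..<n} \<times> {..<4 * n}) ({..<2 * n} \<times> {..<2 * n})"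
    (is "bij_betw ?f ?A ?B")
proof (rule bij_betw_if_surj_card)
  show "?f ` ?A = ?B"
  proof (rule subset_antisym)
    show "?f ` ?A \<subseteq> ?B"
      by (rule image_subsetI) (simp add: case_prod_beta less)
    show "?B \<subseteq> ?f ` ?A"
    proof
      fix p assume "p \<in> ?B"
      then obtain k j where "k < n" "j < 4 * n" "f k j = p"
        using surj[of "fst p" "snd p"] by (auto simp: mem_Times_iff)
      then show "p \<in> ?f ` ?A"
        by (intro rev_image_eqI[of "(k, j)"]) auto
    qed
  qed
qed (auto simp: card_cartesian_product)

lemma bij_betw_stair_pos:
  assumes "n > 0"
  shows "bij_betw (\<lambda>(k, j). stair_pos n k j) ({..<n} \<times> {..<4 * n}) ({..<2 * n} \<times> {..<2 * n})"
  using stair_pos_less[OF assms] by (rule bij_betw_torus) (metis stair_pos_surj)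

lemma bij_betw_pend_pos:
  assumes "n > 0"
  shows "bij_betw (\<lambda>(k, j). pend_pos n k j) ({..<n} \<times> {..<4 * n}) ({..<2 * n} \<times> {..<2 * n})"
  using pend_pos_less[OF assms] by (rule bij_betw_torus) (metis pend_arc_cases)

lemma two_to_one_stair_cover:
  assumes "n > 0"
  shows "two_to_one_on_verts (stair_cover n) (copies n (sunlet (4 * n)))
    (cycle_graph (2 * n) \<box> cycle_graph (2 * n))"
  unfolding two_to_one_on_verts_def
proof
  fix w assume "w \<in> verts (cycle_graph (2 * n) \<box> cycle_graph (2 * n))"
  then have w: "w \<in> {..<2 * n} \<times> {..<2 * n}"
    by (simp add: verts_torus)
  \<comment> \<open>Phrased as an equivalence, uniqueness rewrites each half of the fibre of
    \<open>w\<close> to a singleton: one rim vertex and one leaf.\<close>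
  have unique: "\<exists>k j. \<forall>k' j'. k' < n \<and> j' < 4 * n \<and> f k' j' = w \<longleftrightarrow> k' = k \<and> j' = j"
    if "bij_betw (\<lambda>(k, j). f k j) ({..<n} \<times> {..<4 * n}) ({..<2 * n} \<times> {..<2 * n})" for f
  proof -
    have "w \<in> (\<lambda>(k, j). f k j) ` ({..<n} \<times> {..<4 * n})"
      using that w by (simp add: bij_betw_def)
    then obtain k j where "k < n" "j < 4 * n" "f k j = w"
      by auto
    moreover from this have "k' = k \<and> j' = j" if "k' < n" "j' < 4 * n" "f k' j' = w" for k' j'
      using inj_onD[OF bij_betw_imp_inj_on, OF \<open>bij_betw _ _ _\<close>, of "(k', j')" "(k, j)"] that
      by simp
    ultimately show ?thesis by blast
  qed
  obtain k j where
    "\<And>k' j'. k' < n \<and> j' < 4 * n \<and> stair_pos n k' j' = w \<longleftrightarrow> k' = k \<and> j' = j"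
    using unique[OF bij_betw_stair_pos[OF assms]] by blast
  moreover obtain l i where
    "\<And>k' j'. k' < n \<and> j' < 4 * n \<and> pend_pos n k' j' = w \<longleftrightarrow> k' = l \<and> j' = i"
    using unique[OF bij_betw_pend_pos[OF assms]] by blast
  moreover have "verts (copies n (sunlet (4 * n))) =
      {(k, Rim j) | k j. k < n \<and> j < 4 * n} \<union> {(k, Leaf j) | k j. k < n \<and> j < 4 * n}"
    by (auto simp: copies_def sunlet_def)
  then have "{v \<in> verts (copies n (sunlet (4 * n))). stair_cover n v = w} =
      {(k, Rim j) | k j. k < n \<and> j < 4 * n \<and> stair_pos n k j = w} \<union>
      {(k, Leaf j) | k j. k < n \<and> j < 4 * n \<and> pend_pos n k j = w}"
    by auto
  ultimately have
    "{v \<in> verts (copies n (sunlet (4 * n))). stair_cover n v = w} = {(k, Rim j), (l, Leaf i)}"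
    by (simp only:) auto
  then show "card {v \<in> verts (copies n (sunlet (4 * n))). stair_cover n v = w} = 2"
    by simp
qed

section \<open>Action on arcs\<close>

lemma compatible_stair_cover:
  assumes "n > 0"
  shows "compatible (stair_cover n) (copies_arcs n (FSM_orientation (4 * n)))
    (standard_orientation (2 * n))"
proof -
  have rim: "(stair_pos n k j, stair_pos n k (Suc j mod (4 * n))) \<in> standard_orientation (2 * n)"
    if "j < 4 * n" for k j
    using stair_pos_less[OF assms, of k j] that
    by (cases "stair_pos n k j")
      (auto simp: stair_pos_mod stair_pos_Suc standard_orientation_def)
  have pend: "(pend_pos n k j, stair_pos n k j) \<in> standard_orientation (2 * n)" for k j
    using stair_pos_less[OF assms, of k j] Suc_pred_mod[of _ "2 * n"]
    by (cases "stair_pos n k j") (auto simp: pend_pos_def standard_orientation_def)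
  show ?thesis
    using rim pend by (auto simp: compatible_def copies_arcs_def FSM_orientation_def)
qed

lemma bij_betw_stair_cover_arcs:
  assumes "n > 0"
  shows "bij_betw (map_prod (stair_cover n) (stair_cover n))
    (copies_arcs n (FSM_orientation (4 * n))) (standard_orientation (2 * n))"
    (is "bij_betw ?f ?D ?S")
proof (rule bij_betw_if_surj_card)
  show "finite ?D"
    by (intro finite_copies_arcs finite_FSM_orientation)
  \<comment> \<open>\<open>n\<close> copies with 8n arcs each, against 2 arcs for each of the 4n^2
    vertices.\<close>
  show "card ?D = card ?S"
    using assms by (simp add: card_copies_arcs card_FSM_orientation card_standard_orientation)
  have rim: "(stair_pos n k j, stair_pos n k (Suc j)) \<in> ?f ` ?D" if "k < n" "j < 4 * n" for k j
    using that
    by (intro rev_image_eqI[of "((k, Rim j), (k, Rim (Suc j mod (4 * n))))"])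
      (auto simp: stair_pos_mod copies_arcs_def FSM_orientation_def)
  have pend: "(pend_pos n k j, stair_pos n k j) \<in> ?f ` ?D" if "k < n" "j < 4 * n" for k j
    using that
    by (intro rev_image_eqI[of "((k, Leaf j), (k, Rim j))"])
      (auto simp: copies_arcs_def FSM_orientation_def)
  \<comment> \<open>Of the two arcs leaving \<open>(a, b)\<close>, one is the image of a rim arc and
    the other of a pendant arc; the parity of \<open>a + b\<close> decides which.\<close>
  have "((a, b), (Suc a mod (2 * n), b)) \<in> ?f ` ?D \<and> ((a, b), (a, Suc b mod (2 * n))) \<in> ?f ` ?D"
    if ab: "a < 2 * n" "b < 2 * n" for a b
  proof -
    obtain k j where "k < n" "j < 4 * n" "stair_pos n k j = (a, b)"
      "stair_pos n k (Suc j) =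
        (if even (a + b) then (Suc a mod (2 * n), b) else (a, Suc b mod (2 * n)))"
      using stair_arc_cases[OF ab] .
    note out_rim = rim[OF this(1,2), unfolded this(3,4)]
    obtain k j where "k < n" "j < 4 * n" "pend_pos n k j = (a, b)"
      "stair_pos n k j = (if even (a + b) then (a, Suc b mod (2 * n)) else (Suc a mod (2 * n), b))"
      using pend_arc_cases[OF ab] .
    note out_pend = pend[OF this(1,2), unfolded this(3,4)]
    show ?thesis
      using out_rim out_pend by (cases "even (a + b)") (simp_all only: if_True if_False simp_thms)
  qed
  then have "?S \<subseteq> ?f ` ?D"
    by (auto simp: standard_orientation_def)
  moreover have "?f ` ?D \<subseteq> ?S"
    using compatible_stair_cover[OF assms] by (force simp: compatible_def)
  ultimately show "?f ` ?D = ?S"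
    by (rule subset_antisym[rotated])
qed

text \<open>With \<open>n \<ge> 2\<close> the torus has side at least 4. On side 2, opposite arcs
  would share an edge and the passage from arcs to edges would fail.\<close>

lemma covering_stair_cover:
  assumes "n \<ge> 2"
  shows "covering (stair_cover n) (copies n (sunlet (4 * n)))
    (cycle_graph (2 * n) \<box> cycle_graph (2 * n))"
proof (rule covering_if_bij_betw_arcs)
  show "orientation (copies_arcs n (FSM_orientation (4 * n))) (copies n (sunlet (4 * n)))"
    using assms by (intro orientation_copies orientation_FSM) simp
  show "orientation (standard_orientation (2 * n)) (cycle_graph (2 * n) \<box> cycle_graph (2 * n))"
    using assms by (intro orientation_standard) simp
  show "bij_betw (map_prod (stair_cover n) (stair_cover n))
    (copies_arcs n (FSM_orientation (4 * n))) (standard_orientation (2 * n))"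
    using assms by (intro bij_betw_stair_cover_arcs) simp
  show "stair_cover n ` verts (copies n (sunlet (4 * n)))
    \<subseteq> verts (cycle_graph (2 * n) \<box> cycle_graph (2 * n))"
    unfolding verts_torus
  proof (rule image_subsetI)
    fix v :: "nat \<times> sunlet_vertex"
    show "stair_cover n v \<in> {..<2 * n} \<times> {..<2 * n}"
      using assms stair_pos_less[of n] pend_pos_less[of n]
      by (cases "(n, v)" rule: stair_cover.cases) simp_all
  qed
qed

section \<open>The staircases as images of the rims\<close>

lemma staircase_eq: "staircase n k = map_graph (stair_pos n k) (cycle_graph (4 * n))"
  by (simp add: staircase_def map_graph_map_graph stair_seq_def stair_pos_def[abs_def] mod_add_left_eq)

text \<open>Injectivity of \<open>stair_pos\<close> in copy and index jointly makes the staircases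
  pairwise disjoint, so the isomorphisms on the single rims fit together.\<close>

lemma graph_iso_stair_cover:
  assumes "n > 0"
  shows "graph_iso (stair_cover n) (copies n (sunlet_rim (4 * n)))
    (graph_Union (staircase n ` {..<n}))"
proof -
  have "inj_on (stair_cover n) (verts (copies n (sunlet_rim (4 * n))))"
    using bij_betw_imp_inj_on[OF bij_betw_stair_pos[OF assms]]
    by (auto simp: inj_on_def copies_def verts_sunlet_rim)
  moreover have "e \<subseteq> verts (copies n (sunlet_rim (4 * n)))"
    if "e \<in> edges (copies n (sunlet_rim (4 * n)))" for e
    using that by (auto simp: copies_def verts_sunlet_rim edges_sunlet_rim)
  moreover have "map_graph (stair_cover n) (copies n (sunlet_rim (4 * n)))
      = graph_Union (staircase n ` {..<n})"
    using assms by (simp add: map_graph_copies sunlet_rim_def map_graph_map_graph staircase_eq)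
  ultimately show ?thesis
    by (metis graph_iso_map_graph)
qed

theorem theorem2:
  fixes n :: nat
  assumes "n \<ge> 2"
  shows "\<exists>\<phi>.
    graph_hom \<phi> (copies n (sunlet (4 * n))) (cycle_graph (2 * n) \<box> cycle_graph (2 * n)) \<and>
    covering \<phi> (copies n (sunlet (4 * n))) (cycle_graph (2 * n) \<box> cycle_graph (2 * n)) \<and>
    two_to_one_on_verts \<phi> (copies n (sunlet (4 * n))) (cycle_graph (2 * n) \<box> cycle_graph (2 * n)) \<and>
    graph_iso \<phi> (copies n (unique_cycle (sunlet (4 * n)))) (graph_Union (staircase n ` {..<n})) \<and>
    compatible \<phi> (copies_arcs n (FSM_orientation (4 * n))) (standard_orientation (2 * n))"
proof -
  have "unique_cycle (sunlet (4 * n)) = sunlet_rim (4 * n)"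
    using assms by (intro unique_cycle_sunlet) simp
  moreover have "n > 0"
    using assms by simp
  ultimately show ?thesis
    using covering_stair_cover[OF assms] two_to_one_stair_cover graph_iso_stair_cover
      compatible_stair_cover
    by (intro exI[of _ "stair_cover n"]) (simp add: covering_def)
qed

end
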